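(* Let $C$ be the Cesàro operator on the Hardy space $H^2$. For $A\in\mathcal{B}(H^2)$ the following are equivalent. (i) $A^2=C$. (ii) $$A=\pm\left(I-\sum_{k=1}^\infty\left|\binom{1/2}{k}\right|(I-C)^k\right)=\pm\left(I-\tfrac12(I-C)-\tfrac18(I-C)^2-\tfrac1{16}(I-C)^3-\cdots\right),$$ for one of the two choices of sign, where the series converges in operator norm.
   Context: $H^2$ is the Hardy space of the open unit disc $\mathbb{D}$ and $\mathcal{B}(H^2)$ the bounded linear operators on it. The Cesàro operator $C:H^2\to H^2$ is the bounded operator $(Cf)(z)=\frac1z\int_0^z\frac{f(\xi)}{1-\xi}\,d\xi$; equivalently, if $f(z)=\sum_{j\ge0}a_jz^j$, then $(Cf)(z)=\sum_{n=0}^\infty\left(\frac1{n+1}\sum_{j=0}^na_j\right)z^n$. The coefficients are those of the Taylor series $\sqrt{1-z}=1-\sum_{k=1}^\infty\left|\binom{1/2}{k}\right|z^k$ (branch with $\sqrt1=1$). *)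

theory Defs
  imports "HOL-Complex_Analysis.Complex_Analysis"
begin

section \<open>Taylor coefficients at the origin\<close>

definition taylor_coeff :: "(complex \<Rightarrow> complex) \<Rightarrow> nat \<Rightarrow> complex" where
  "taylor_coeff f n = (deriv ^^ n) f 0 / fact n"

lemma taylor_sums:
  assumes "f holomorphic_on ball 0 1" "z \<in> ball 0 1"
  shows "(\<lambda>n. taylor_coeff f n * z ^ n) sums f z"
  using holomorphic_power_series[OF assms] by (simp add: taylor_coeff_def)

lemma taylor_coeff_unique:
  assumes "\<And>z. z \<in> ball 0 1 \<Longrightarrow> (\<lambda>n. a n * z ^ n) sums f z"
  shows "taylor_coeff f n = a n"
proof -
  have "f has_fps_expansion Abs_fps a"
  proof (rule has_fps_expansionI)
    show "\<forall>\<^sub>F u in nhds 0. (\<lambda>n. fps_nth (Abs_fps a) n * u ^ n) sums f u"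
      using eventually_nhds_in_open[of "ball 0 1" "0::complex"]
      by (rule eventually_mono[OF _ _]) (use assms in auto)
  qed
  from fps_nth_fps_expansion[OF this, of n] show ?thesis
    by (simp add: taylor_coeff_def)
qed

lemma holomorphic_of_sums:
  assumes "\<And>z. z \<in> ball 0 1 \<Longrightarrow> (\<lambda>n. a n * z ^ n) sums f z"
  shows "f holomorphic_on ball 0 1"
  using power_series_holomorphic[of 0 1 a f] assms by simp

lemma square_summable_imp_power_summable:
  fixes a :: "nat \<Rightarrow> complex"
  assumes "summable (\<lambda>n. (cmod (a n))\<^sup>2)" "cmod z < 1"
  shows "summable (\<lambda>n. a n * z ^ n)"
proof -
  have z2: "(cmod z)\<^sup>2 < 1"
    using assms(2) by (simp add: abs_square_less_1)
  have "summable (\<lambda>n. (cmod (a n))\<^sup>2 + ((cmod z)\<^sup>2) ^ n)"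
    using assms(1) z2 by (intro summable_add summable_geometric) auto
  then show ?thesis
  proof (rule summable_comparison_test'[where N = 0])
    fix n :: nat
    have "2 * (cmod (a n) * cmod z ^ n) \<le> (cmod (a n))\<^sup>2 + (cmod z ^ n)\<^sup>2"
      using sum_squares_bound[of "cmod (a n)" "cmod z ^ n"] by (simp add: mult.assoc)
    moreover have "0 \<le> cmod (a n) * cmod z ^ n" by simp
    ultimately have "cmod (a n) * cmod z ^ n \<le> (cmod (a n))\<^sup>2 + (cmod z ^ n)\<^sup>2"
      by linarith
    then show "norm (a n * z ^ n) \<le> (cmod (a n))\<^sup>2 + ((cmod z)\<^sup>2) ^ n"
      by (simp add: norm_mult norm_power power_mult[symmetric] mult.commute)
  qed
qed

section \<open>The Hardy space of the unit disc\<close>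

text \<open>
  Functions are total in HOL, so a function on the open unit disc is represented by its
  extension by zero; the value outside the disc carries no information.
\<close>

definition hardy2_set :: "(complex \<Rightarrow> complex) set" where
  "hardy2_set = {f. f holomorphic_on ball 0 1 \<and> (\<forall>z. z \<notin> ball 0 1 \<longrightarrow> f z = 0) \<and>
     summable (\<lambda>n. (cmod (taylor_coeff f n))\<^sup>2)}"

lemma hardy2_setI:
  assumes "\<And>z. z \<in> ball 0 1 \<Longrightarrow> (\<lambda>n. a n * z ^ n) sums f z"
    and "\<And>z. z \<notin> ball 0 1 \<Longrightarrow> f z = 0"
    and "summable (\<lambda>n. (cmod (a n))\<^sup>2)"
  shows "f \<in> hardy2_set"
  using assms holomorphic_of_sums[of a f] taylor_coeff_unique[of a f]
  by (simp add: hardy2_set_def)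

lemma hardy2_set_sums:
  "f \<in> hardy2_set \<Longrightarrow> z \<in> ball 0 1 \<Longrightarrow> (\<lambda>n. taylor_coeff f n * z ^ n) sums f z"
  by (simp add: hardy2_set_def taylor_sums)

typedef hardy2 = hardy2_set
proof
  show "(\<lambda>_. 0) \<in> hardy2_set"
    by (rule hardy2_setI[of "\<lambda>_. 0"]) auto
qed

setup_lifting type_definition_hardy2

lift_definition hcoeff :: "hardy2 \<Rightarrow> nat \<Rightarrow> complex" is taylor_coeff .

lift_definition heval :: "hardy2 \<Rightarrow> complex \<Rightarrow> complex" is "\<lambda>f. f" .

lemma summable_hcoeff: "summable (\<lambda>n. (cmod (hcoeff f n))\<^sup>2)"
  by transfer (simp add: hardy2_set_def)

lemma heval_sums: "cmod z < 1 \<Longrightarrow> (\<lambda>n. hcoeff f n * z ^ n) sums heval f z"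
  by transfer (simp add: hardy2_set_sums)

lemma heval_holomorphic: "heval f holomorphic_on ball 0 1"
  by transfer (simp add: hardy2_set_def)

lemma heval_outside: "\<not> cmod z < 1 \<Longrightarrow> heval f z = 0"
  by transfer (simp add: hardy2_set_def)

lemma hcoeff_unique:
  assumes "\<And>z. cmod z < 1 \<Longrightarrow> (\<lambda>n. a n * z ^ n) sums heval f z"
  shows "hcoeff f n = a n"
  unfolding hcoeff.rep_eq
  by (rule taylor_coeff_unique) (use assms in \<open>auto simp: heval.rep_eq\<close>)

lemma hardy2_eqI:
  assumes "\<And>n. hcoeff f n = hcoeff g n"
  shows "f = g"
proof -
  have "heval f z = heval g z" for z
  proof (cases "cmod z < 1")
    case True
    then show ?thesis
      using heval_sums[OF True, of f] heval_sums[OF True, of g] assms by (simp add: sums_iff)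
  qed (simp add: heval_outside)
  then have "heval f = heval g" by blast
  then show ?thesis by transfer
qed

lemma hardy2_ex_coeff:
  assumes "summable (\<lambda>n. (cmod (a n))\<^sup>2)"
  obtains f where "\<And>n. hcoeff f n = a n"
proof -
  define F where "F = (\<lambda>z. if z \<in> ball 0 1 then \<Sum>n. a n * z ^ n else 0)"
  have s: "(\<lambda>n. a n * z ^ n) sums F z" if "z \<in> ball 0 1" for z
    using square_summable_imp_power_summable[OF assms, of z] that
    by (auto simp: F_def sums_iff)
  have F: "F \<in> hardy2_set"
    by (rule hardy2_setI[OF s _ assms]) (auto simp: F_def)
  have "hcoeff (Abs_hardy2 F) n = a n" for n
    using taylor_coeff_unique[OF s] F by (simp add: hcoeff.rep_eq Abs_hardy2_inverse)
  then show ?thesis by (rule that)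
qed

lemma summable_square_add:
  fixes a b :: "nat \<Rightarrow> complex"
  assumes "summable (\<lambda>n. (cmod (a n))\<^sup>2)" "summable (\<lambda>n. (cmod (b n))\<^sup>2)"
  shows "summable (\<lambda>n. (cmod (a n + b n))\<^sup>2)"
proof -
  have "summable (\<lambda>n. 2 * (cmod (a n))\<^sup>2 + 2 * (cmod (b n))\<^sup>2)"
    using assms by (intro summable_add summable_mult)
  then show ?thesis
  proof (rule summable_comparison_test'[where N = 0])
    fix n :: nat
    have "(cmod (a n + b n))\<^sup>2 \<le> (cmod (a n) + cmod (b n))\<^sup>2"
      by (intro power_mono norm_triangle_ineq) auto
    also have "\<dots> \<le> 2 * (cmod (a n))\<^sup>2 + 2 * (cmod (b n))\<^sup>2"
      using sum_squares_bound[of "cmod (a n)" "cmod (b n)"] by (simp add: power2_sum)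
    finally show "norm ((cmod (a n + b n))\<^sup>2) \<le> 2 * (cmod (a n))\<^sup>2 + 2 * (cmod (b n))\<^sup>2"
      by simp
  qed
qed

lemma summable_square_cmult:
  fixes a :: "nat \<Rightarrow> complex"
  assumes "summable (\<lambda>n. (cmod (a n))\<^sup>2)"
  shows "summable (\<lambda>n. (cmod (c * a n))\<^sup>2)"
  using summable_mult[OF assms, of "(cmod c)\<^sup>2"] by (simp add: norm_mult power_mult_distrib)

lift_definition hscaleC :: "complex \<Rightarrow> hardy2 \<Rightarrow> hardy2" is "\<lambda>c f z. c * f z"
  subgoal for c f
    by (rule hardy2_setI[of "\<lambda>n. c * taylor_coeff f n"])
      (use hardy2_set_sums[of f] summable_square_cmult[of "taylor_coeff f" c] in
        \<open>auto simp: hardy2_set_def mult.assoc intro: sums_mult\<close>)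
  done

lemma heval_hscaleC [simp]: "heval (hscaleC c f) z = c * heval f z"
  by transfer simp

lemma hcoeff_hscaleC [simp]: "hcoeff (hscaleC c f) n = c * hcoeff f n"
  by (rule hcoeff_unique) (auto simp: mult.assoc intro: sums_mult heval_sums)

instantiation hardy2 :: real_vector
begin

lift_definition zero_hardy2 :: hardy2 is "\<lambda>_. 0"
  by (rule hardy2_setI[of "\<lambda>_. 0"]) auto

lift_definition plus_hardy2 :: "hardy2 \<Rightarrow> hardy2 \<Rightarrow> hardy2" is "\<lambda>f g z. f z + g z"
  subgoal for f g
    by (rule hardy2_setI[of "\<lambda>n. taylor_coeff f n + taylor_coeff g n"])
      (use hardy2_set_sums[of f] hardy2_set_sums[of g]
        summable_square_add[of "taylor_coeff f" "taylor_coeff g"] in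
        \<open>auto simp: hardy2_set_def distrib_right intro: sums_add\<close>)
  done

definition scaleR_hardy2 :: "real \<Rightarrow> hardy2 \<Rightarrow> hardy2" where
  "scaleR_hardy2 r f = hscaleC (of_real r) f"

definition uminus_hardy2 :: "hardy2 \<Rightarrow> hardy2" where
  "uminus_hardy2 f = hscaleC (- 1) f"

definition minus_hardy2 :: "hardy2 \<Rightarrow> hardy2 \<Rightarrow> hardy2" where
  "minus_hardy2 f g = f + - g"

lemma hcoeff_zero [simp]: "hcoeff 0 n = 0"
  by (rule hcoeff_unique) (simp add: zero_hardy2.rep_eq heval.rep_eq)

lemma heval_add [simp]: "heval (f + g) z = heval f z + heval g z"
  by (simp add: plus_hardy2.rep_eq heval.rep_eq)

lemma hcoeff_add [simp]: "hcoeff (f + g) n = hcoeff f n + hcoeff g n"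
  by (rule hcoeff_unique) (auto simp: distrib_right intro: sums_add heval_sums)

lemma hcoeff_scaleR [simp]: "hcoeff (r *\<^sub>R f) n = of_real r * hcoeff f n"
  by (simp add: scaleR_hardy2_def)

lemma hcoeff_uminus [simp]: "hcoeff (- f) n = - hcoeff f n"
  by (simp add: uminus_hardy2_def)

lemma hcoeff_diff [simp]: "hcoeff (f - g) n = hcoeff f n - hcoeff g n"
  by (simp add: minus_hardy2_def)

instance
proof
  fix f g h :: hardy2 and r s :: real
  show "f + g + h = f + (g + h)" by (rule hardy2_eqI) simp
  show "f + g = g + f" by (rule hardy2_eqI) simp
  show "0 + f = f" by (rule hardy2_eqI) simp
  show "- f + f = 0" by (rule hardy2_eqI) simp
  show "f - g = f + - g" by (rule hardy2_eqI) simp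
  show "r *\<^sub>R (f + g) = r *\<^sub>R f + r *\<^sub>R g"
    by (rule hardy2_eqI) (simp add: distrib_left)
  show "(r + s) *\<^sub>R f = r *\<^sub>R f + s *\<^sub>R f"
    by (rule hardy2_eqI) (simp add: distrib_right)
  show "r *\<^sub>R s *\<^sub>R f = (r * s) *\<^sub>R f" by (rule hardy2_eqI) simp
  show "1 *\<^sub>R f = f" by (rule hardy2_eqI) simp
qed

end

lemma summable_hcoeff_inner: "summable (\<lambda>n. Re (hcoeff f n * cnj (hcoeff g n)))"
proof -
  have "summable (\<lambda>n. (cmod (hcoeff f n))\<^sup>2 + (cmod (hcoeff g n))\<^sup>2)"
    by (intro summable_add summable_hcoeff)
  then show ?thesis
  proof (rule summable_comparison_test'[where N = 0])
    fix n :: nat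
    have "\<bar>Re (hcoeff f n * cnj (hcoeff g n))\<bar> \<le> cmod (hcoeff f n) * cmod (hcoeff g n)"
      using abs_Re_le_cmod[of "hcoeff f n * cnj (hcoeff g n)"] by (simp add: norm_mult)
    moreover have "0 \<le> cmod (hcoeff f n) * cmod (hcoeff g n)" by simp
    moreover have "2 * (cmod (hcoeff f n) * cmod (hcoeff g n))
        \<le> (cmod (hcoeff f n))\<^sup>2 + (cmod (hcoeff g n))\<^sup>2"
      using sum_squares_bound[of "cmod (hcoeff f n)" "cmod (hcoeff g n)"]
      by (simp add: mult.assoc)
    ultimately show "norm (Re (hcoeff f n * cnj (hcoeff g n)))
        \<le> (cmod (hcoeff f n))\<^sup>2 + (cmod (hcoeff g n))\<^sup>2"
      by simp
  qed
qed

text \<open>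
  The class \<open>real_inner\<close> carries the real part of the complex inner product
  \<open>\<Sum>n. a n * cnj (b n)\<close>; it induces the usual Hardy space norm.
\<close>

instantiation hardy2 :: real_inner
begin

definition inner_hardy2 :: "hardy2 \<Rightarrow> hardy2 \<Rightarrow> real" where
  "inner_hardy2 f g = (\<Sum>n. Re (hcoeff f n * cnj (hcoeff g n)))"

definition norm_hardy2 :: "hardy2 \<Rightarrow> real" where
  "norm_hardy2 f = sqrt (\<Sum>n. (cmod (hcoeff f n))\<^sup>2)"

definition sgn_hardy2 :: "hardy2 \<Rightarrow> hardy2" where
  "sgn_hardy2 f = inverse (norm f) *\<^sub>R f"

definition dist_hardy2 :: "hardy2 \<Rightarrow> hardy2 \<Rightarrow> real" where
  "dist_hardy2 f g = norm (f - g)"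

definition uniformity_hardy2 :: "(hardy2 \<times> hardy2) filter" where
  "uniformity_hardy2 = (INF e\<in>{0<..}. principal {(x, y). dist x y < e})"

definition open_hardy2 :: "hardy2 set \<Rightarrow> bool" where
  "open_hardy2 U \<longleftrightarrow> (\<forall>x\<in>U. \<forall>\<^sub>F (x', y) in uniformity. x' = x \<longrightarrow> y \<in> U)"

instance
proof
  have self: "inner f f = (\<Sum>n. (cmod (hcoeff f n))\<^sup>2)" for f :: hardy2
    unfolding inner_hardy2_def cmod_power2 by (simp add: power2_eq_square)
  fix f g h :: hardy2 and r :: real and U :: "hardy2 set"
  show "dist f g = norm (f - g)" by (simp add: dist_hardy2_def)
  show "sgn f = f /\<^sub>R norm f" by (simp add: sgn_hardy2_def)
  show "uniformity = (INF e\<in>{0<..}. principal {(x, y :: hardy2). dist x y < e})"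
    by (simp add: uniformity_hardy2_def)
  show "open U = (\<forall>x\<in>U. \<forall>\<^sub>F (x', y) in uniformity. x' = x \<longrightarrow> y \<in> U)"
    by (simp add: open_hardy2_def)
  show "inner f g = inner g f"
    by (simp add: inner_hardy2_def mult.commute)
  show "inner (f + g) h = inner f h + inner g h"
    unfolding inner_hardy2_def
    by (subst suminf_add[OF summable_hcoeff_inner summable_hcoeff_inner])
      (simp add: algebra_simps)
  show "inner (r *\<^sub>R f) g = r * inner f g"
    unfolding inner_hardy2_def
    by (subst suminf_mult[OF summable_hcoeff_inner, symmetric])
      (simp add: algebra_simps)
  show "0 \<le> inner f f"
    unfolding self by (intro suminf_nonneg summable_hcoeff) simp
  show "inner f f = 0 \<longleftrightarrow> f = 0"
  proof
    assume "inner f f = 0"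
    then have "\<forall>n. (cmod (hcoeff f n))\<^sup>2 = 0"
      unfolding self using suminf_eq_zero_iff[OF summable_hcoeff, of f] by simp
    then show "f = 0" by (intro hardy2_eqI) simp
  qed (simp add: self)
  show "norm f = sqrt (inner f f)"
    by (simp add: self norm_hardy2_def)
qed

end

section \<open>The Cesaro operator\<close>

lemma cesaro_taylor:
  assumes f: "f holomorphic_on ball 0 1" and z: "z \<in> ball 0 1"
  shows "(\<lambda>n. (\<Sum>j\<le>n. taylor_coeff f j) / of_nat (Suc n) * z ^ n) sums
    (if z = 0 then f 0 else contour_integral (linepath 0 z) (\<lambda>w. f w / (1 - w)) / z)"
proof -
  define h where "h = (\<lambda>w. f w / (1 - w))"
  have h: "h holomorphic_on ball 0 1"
    unfolding h_def using f by (intro holomorphic_intros) auto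
  have "\<exists>G. \<forall>x\<in>ball 0 1. (G has_field_derivative h x) (at x within ball 0 1)"
  proof (rule holomorphic_convex_primitive'[OF convex_ball open_ball h])
    fix g
    assume "\<And>x. x \<in> ball 0 1 \<Longrightarrow> (g has_field_derivative h x) (at x within ball 0 1)"
    then show ?thesis by (intro exI[of _ g] ballI)
  qed
  then obtain G where
    G: "\<forall>x\<in>ball 0 1. (G has_field_derivative h x) (at x within ball 0 1)" ..
  have G': "(G has_field_derivative h x) (at x)" if "x \<in> ball 0 1" for x
    using bspec[OF G that] that by (simp add: at_within_open[OF _ open_ball])
  have hs: "(\<lambda>n. (\<Sum>j\<le>n. taylor_coeff f j) * w ^ n) sums h w" if w: "w \<in> ball 0 1" for w
  proof -
    have "(\<lambda>n. \<Sum>j\<le>n. (taylor_coeff f j * w ^ j) * w ^ (n - j)) sums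
        ((\<Sum>n. taylor_coeff f n * w ^ n) * (\<Sum>n. w ^ n))"
    proof (rule Cauchy_product_sums)
      show "summable (\<lambda>n. norm (w ^ n))"
        using w by (simp add: norm_power summable_geometric)
      obtain r where r: "cmod w < r" "r < 1"
        using w dense[of "cmod w" 1] by auto
      have "r > 0" using r by (meson norm_ge_zero le_less_trans)
      have "summable (\<lambda>n. taylor_coeff f n * (of_real r) ^ n)"
        using taylor_sums[OF f, of "of_real r"] r \<open>r > 0\<close> by (auto simp: sums_iff)
      from powser_insidea[OF this, of w] r \<open>r > 0\<close>
      show "summable (\<lambda>n. norm (taylor_coeff f n * w ^ n))" by simp
    qed
    also have "(\<lambda>n. \<Sum>j\<le>n. (taylor_coeff f j * w ^ j) * w ^ (n - j)) =
        (\<lambda>n. (\<Sum>j\<le>n. taylor_coeff f j) * w ^ n)"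
      by (auto simp: fun_eq_iff sum_distrib_right mult.assoc power_add[symmetric] intro!: sum.cong)
    also have "(\<Sum>n. taylor_coeff f n * w ^ n) * (\<Sum>n. w ^ n) = h w"
      using taylor_sums[OF f w] w by (simp add: sums_iff suminf_geometric h_def)
    finally show ?thesis .
  qed
  have hc: "taylor_coeff h n = (\<Sum>j\<le>n. taylor_coeff f j)" for n
    by (rule taylor_coeff_unique[OF hs])
  have Ghol: "G holomorphic_on ball 0 1"
    unfolding holomorphic_on_def field_differentiable_def using G by blast
  have Gc: "taylor_coeff G (Suc n) = (\<Sum>j\<le>n. taylor_coeff f j) / of_nat (Suc n)" for n
  proof -
    have "(deriv ^^ n) (deriv G) 0 = (deriv ^^ n) h 0"
    proof (rule higher_deriv_cong_ev)
      show "\<forall>\<^sub>F x in nhds 0. deriv G x = h x"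
        using eventually_nhds_in_open[of "ball 0 1" "0::complex"]
        by (rule eventually_mono[OF _ _]) (use G' DERIV_imp_deriv in auto)
    qed simp
    then have "(deriv ^^ Suc n) G 0 = (deriv ^^ n) h 0"
      by (simp only: funpow_Suc_right o_apply)
    then have "taylor_coeff G (Suc n) = taylor_coeff h n / of_nat (Suc n)"
      unfolding taylor_coeff_def
      by (simp only: fact_Suc divide_divide_eq_left mult.commute of_nat_mult of_nat_fact)
    then show ?thesis by (simp only: hc)
  qed
  show ?thesis
  proof (cases "z = 0")
    case True
    have "f 0 = taylor_coeff f 0" by (simp add: taylor_coeff_def)
    then show ?thesis
      using True powser_sums_zero[of "\<lambda>n. (\<Sum>j\<le>n. taylor_coeff f j) / of_nat (Suc n)"]
      by simp
  next
    case False
    have seg: "path_image (linepath 0 z) \<subseteq> ball 0 1"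
      using z by (simp add: closed_segment_subset)
    have "(h has_contour_integral (G (pathfinish (linepath 0 z)) - G (pathstart (linepath 0 z))))
        (linepath 0 z)"
      by (rule contour_integral_primitive[OF bspec[OF G] _ seg]) auto
    then have ci: "contour_integral (linepath 0 z) h = G z - G 0"
      by (simp add: contour_integral_unique)
    have "taylor_coeff G 0 = G 0" by (simp add: taylor_coeff_def)
    then have "(\<lambda>n. taylor_coeff G (Suc n) * z ^ Suc n) sums (G z - G 0)"
      using taylor_sums[OF Ghol z] by (subst sums_Suc_iff) simp
    from sums_divide[OF this, of z] have
      "(\<lambda>n. taylor_coeff G (Suc n) * z ^ n) sums ((G z - G 0) / z)"
      using False by simp
    then show ?thesis
      using False ci unfolding Gc h_def by simp
  qed
qed

lemma hardy_inequality_partial: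
  fixes a :: "nat \<Rightarrow> real"
  assumes "\<And>n. a n \<ge> 0"
  shows "(\<Sum>n<N. ((\<Sum>j\<le>n. a j) / Suc n)\<^sup>2) \<le> 4 * (\<Sum>n<N. (a n)\<^sup>2)"
proof -
  define b where "b n = (\<Sum>j\<le>n. a j) / Suc n" for n
  have step: "(b (Suc n))\<^sup>2 - 2 * a (Suc n) * b (Suc n) \<le>
      Suc n * (b n)\<^sup>2 - Suc (Suc n) * (b (Suc n))\<^sup>2" for n
  proof -
    have a: "a (Suc n) = Suc (Suc n) * b (Suc n) - Suc n * b n"
      by (simp add: b_def del: of_nat_Suc)
    have "Suc n * (2 * b (Suc n) * b n) \<le> Suc n * ((b (Suc n))\<^sup>2 + (b n)\<^sup>2)"
      by (intro mult_left_mono sum_squares_bound) simp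
    then show ?thesis
      unfolding a by (simp add: algebra_simps power2_eq_square)
  qed
  have tele: "(\<Sum>n<Suc N. (b n)\<^sup>2 - 2 * a n * b n) \<le> - (Suc N * (b N)\<^sup>2)" for N
  proof (induction N)
    case 0
    show ?case by (simp add: b_def power2_eq_square)
  next
    case (Suc N)
    then show ?case using step[of N] by (simp del: of_nat_Suc)
  qed
  have "(\<Sum>n<N. (b n)\<^sup>2 - 2 * a n * b n) \<le> 0"
  proof (cases N)
    case (Suc M)
    have "0 \<le> Suc M * (b M)\<^sup>2" by simp
    with tele[of M] show ?thesis unfolding Suc by linarith
  qed simp
  moreover have "(\<Sum>n<N. (b n)\<^sup>2 / 2 - 2 * (a n)\<^sup>2) \<le> (\<Sum>n<N. (b n)\<^sup>2 - 2 * a n * b n)"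
  proof (rule sum_mono)
    fix n
    have "0 \<le> (2 * a n - b n)\<^sup>2" by simp
    then show "(b n)\<^sup>2 / 2 - 2 * (a n)\<^sup>2 \<le> (b n)\<^sup>2 - 2 * a n * b n"
      by (simp add: power2_eq_square algebra_simps)
  qed
  ultimately have "(\<Sum>n<N. (b n)\<^sup>2 / 2 - 2 * (a n)\<^sup>2) \<le> 0" by linarith
  then show ?thesis
    by (simp add: sum_subtractf sum_divide_distrib[symmetric] sum_distrib_left[symmetric] b_def)
qed

lemma hardy_inequality:
  fixes a :: "nat \<Rightarrow> complex"
  assumes "summable (\<lambda>n. (cmod (a n))\<^sup>2)"
  shows "summable (\<lambda>n. (cmod ((\<Sum>j\<le>n. a j) / of_nat (Suc n)))\<^sup>2)"
    and "(\<Sum>n. (cmod ((\<Sum>j\<le>n. a j) / of_nat (Suc n)))\<^sup>2) \<le> 4 * (\<Sum>n. (cmod (a n))\<^sup>2)"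
proof -
  have partial: "(\<Sum>n<N. (cmod ((\<Sum>j\<le>n. a j) / of_nat (Suc n)))\<^sup>2)
      \<le> 4 * (\<Sum>n. (cmod (a n))\<^sup>2)" for N
  proof -
    have "(\<Sum>n<N. (cmod ((\<Sum>j\<le>n. a j) / of_nat (Suc n)))\<^sup>2)
        \<le> (\<Sum>n<N. ((\<Sum>j\<le>n. cmod (a j)) / Suc n)\<^sup>2)"
      unfolding norm_divide norm_of_nat
      by (intro sum_mono power_mono divide_right_mono norm_sum) auto
    also have "\<dots> \<le> 4 * (\<Sum>n<N. (cmod (a n))\<^sup>2)"
      by (rule hardy_inequality_partial) simp
    also have "\<dots> \<le> 4 * (\<Sum>n. (cmod (a n))\<^sup>2)"
      by (intro mult_left_mono sum_le_suminf assms) auto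
    finally show ?thesis .
  qed
  show s: "summable (\<lambda>n. (cmod ((\<Sum>j\<le>n. a j) / of_nat (Suc n)))\<^sup>2)"
    by (rule bounded_imp_summable[of _ "4 * (\<Sum>n. (cmod (a n))\<^sup>2)"])
      (use partial[of "Suc _"] in \<open>auto simp: lessThan_Suc_atMost\<close>)
  show "(\<Sum>n. (cmod ((\<Sum>j\<le>n. a j) / of_nat (Suc n)))\<^sup>2) \<le> 4 * (\<Sum>n. (cmod (a n))\<^sup>2)"
    using s partial by (rule suminf_le_const)
qed

text \<open>At \<open>z = 0\<close> the quotient has a removable singularity with value \<open>f 0\<close>.\<close>

lift_definition cesaro_fun :: "hardy2 \<Rightarrow> hardy2" is
  "\<lambda>f z. if z \<in> ball 0 1
     then (if z = 0 then f 0
           else contour_integral (linepath 0 z) (\<lambda>w. f w / (1 - w)) / z)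
     else 0"
  subgoal for f
    by (rule hardy2_setI[of "\<lambda>n. (\<Sum>j\<le>n. taylor_coeff f j) / of_nat (Suc n)"])
      (use cesaro_taylor[of f] hardy_inequality(1)[of "taylor_coeff f"] in
        \<open>auto simp: hardy2_set_def simp del: of_nat_Suc\<close>)
  done

lemma hcoeff_cesaro_fun:
  "hcoeff (cesaro_fun f) n = (\<Sum>j\<le>n. hcoeff f j) / of_nat (Suc n)"
proof (rule hcoeff_unique)
  fix z :: complex
  assume "cmod z < 1"
  then show "(\<lambda>n. (\<Sum>j\<le>n. hcoeff f j) / of_nat (Suc n) * z ^ n) sums heval (cesaro_fun f) z"
    by transfer (use cesaro_taylor in \<open>auto simp: hardy2_set_def simp del: of_nat_Suc\<close>)
qed

lift_definition cesaro :: "hardy2 \<Rightarrow>\<^sub>L hardy2" is cesaro_fun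
proof (rule bounded_linear_intro[where K = 2])
  fix f g :: hardy2 and r :: real
  show "cesaro_fun (f + g) = cesaro_fun f + cesaro_fun g"
    by (rule hardy2_eqI) (simp add: hcoeff_cesaro_fun sum.distrib add_divide_distrib)
  show "cesaro_fun (r *\<^sub>R f) = r *\<^sub>R cesaro_fun f"
    by (rule hardy2_eqI) (simp add: hcoeff_cesaro_fun sum_distrib_left[symmetric])
  have "norm (cesaro_fun f) \<le> sqrt (4 * (\<Sum>n. (cmod (hcoeff f n))\<^sup>2))"
    unfolding norm_hardy2_def hcoeff_cesaro_fun
    by (intro real_sqrt_le_mono hardy_inequality(2) summable_hcoeff)
  then show "norm (cesaro_fun f) \<le> norm f * 2"
    by (simp add: norm_hardy2_def real_sqrt_mult)
qed

lemma cesaro_integral: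
  assumes "cmod z < 1" "z \<noteq> 0"
  shows "heval (blinfun_apply cesaro f) z =
    contour_integral (linepath 0 z) (\<lambda>w. heval f w / (1 - w)) / z"
  unfolding cesaro.rep_eq using assms by transfer simp

lemma hcoeff_cesaro:
  "hcoeff (blinfun_apply cesaro f) n = (\<Sum>j\<le>n. hcoeff f j) / of_nat (Suc n)"
  by (simp add: cesaro.rep_eq hcoeff_cesaro_fun)

section \<open>Bounded operators\<close>

text \<open>
  The type \<open>hardy2 \<Rightarrow>\<^sub>L hardy2\<close> consists of the bounded real-linear maps.  The bounded operators
  on the complex Hilbert space are those that also commute with complex scalars;
  the operator norm is the same.
\<close>

definition hardy2_operators :: "(hardy2 \<Rightarrow>\<^sub>L hardy2) set" where
  "hardy2_operators =
     {A. \<forall>c f. blinfun_apply A (hscaleC c f) = hscaleC c (blinfun_apply A f)}"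

lemma cesaro_in_operators: "cesaro \<in> hardy2_operators"
  unfolding hardy2_operators_def
  by (auto intro!: hardy2_eqI simp: hcoeff_cesaro sum_distrib_left[symmetric])

primrec blinfun_power ::
    "('a::real_normed_vector \<Rightarrow>\<^sub>L 'a) \<Rightarrow> nat \<Rightarrow> ('a \<Rightarrow>\<^sub>L 'a)" where
  "blinfun_power T 0 = id_blinfun"
| "blinfun_power T (Suc n) = T o\<^sub>L blinfun_power T n"

end

theory Submission
  imports Defs
begin

text \<open>
  For real \<open>\<mu> \<ge> 1\<close> the functional \<open>L\<^sub>\<mu> f = \<Sum>j. (\<Prod>i=1..j. 1 - \<mu> / i) * a\<^sub>j\<close>, where \<open>a\<^sub>j\<close> are the Taylor
  coefficients of \<open>f\<close>, satisfies \<open>L\<^sub>\<mu> (C f) = L\<^sub>\<mu> f / \<mu>\<close>; these eigenfunctionals are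
  unique up to scalars, continuous in \<open>\<mu>\<close>, and those with integer \<open>\<mu>\<close> separate points.
  The series converges because \<open>I - C\<close> is a contraction and the coefficients sum to at most \<open>1\<close>;
  by the scalar binomial series its value \<open>S\<close> satisfies \<open>L\<^sub>\<mu> (S f) = L\<^sub>\<mu> f / sqrt \<mu>\<close>, so \<open>S\<^sup>2 = C\<close>.
  A complex linear square root \<open>A\<close> of \<open>C\<close> commutes with \<open>C\<close>, hence \<open>L\<^sub>\<mu> (A f) = \<alpha> \<mu> * L\<^sub>\<mu> f\<close>
  with \<open>\<alpha> \<mu> = \<plusminus> 1 / sqrt \<mu>\<close>; since \<open>\<alpha>\<close> is continuous on \<open>[1, \<infinity>)\<close>, the sign does not
  depend on \<open>\<mu>\<close>.
\<close>

section \<open>Completeness of the Hardy space\<close>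

lemma norm_hardy2_power2: "(norm f)\<^sup>2 = (\<Sum>n. (cmod (hcoeff f n))\<^sup>2)"
  by (simp add: norm_hardy2_def suminf_nonneg summable_hcoeff)

lemma cmod_hcoeff_le_norm: "cmod (hcoeff f n) \<le> norm f"
proof -
  have "(\<Sum>k\<in>{n}. (cmod (hcoeff f k))\<^sup>2) \<le> (\<Sum>k. (cmod (hcoeff f k))\<^sup>2)"
    by (intro sum_le_suminf summable_hcoeff) auto
  then have "(cmod (hcoeff f n))\<^sup>2 \<le> (norm f)\<^sup>2"
    by (simp add: norm_hardy2_power2)
  then show ?thesis by (rule power2_le_imp_le) simp
qed

lemma norm_hardy2_le:
  assumes "\<And>N. (\<Sum>n<N. (cmod (hcoeff f n))\<^sup>2) \<le> e\<^sup>2" "0 \<le> e"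
  shows "norm f \<le> e"
proof (rule power2_le_imp_le)
  show "(norm f)\<^sup>2 \<le> e\<^sup>2"
    unfolding norm_hardy2_power2 using assms by (intro suminf_le_const summable_hcoeff)
qed fact

text \<open>Coefficientwise limits exist by completeness of the complex numbers, and the Cauchy
  estimate carries over to them. Completeness is what lets the operator series converge by
  comparison of norms.\<close>

instance hardy2 :: banach
proof
  fix X :: "nat \<Rightarrow> hardy2"
  assume X: "Cauchy X"
  have "Cauchy (\<lambda>m. hcoeff (X m) n)" for n
  proof (rule metric_CauchyI)
    fix e :: real assume "0 < e"
    then obtain M where M: "\<And>m k. m \<ge> M \<Longrightarrow> k \<ge> M \<Longrightarrow> dist (X m) (X k) < e"
      using metric_CauchyD[OF X] by blast
    have "dist (hcoeff (X m) n) (hcoeff (X k) n) < e" if "m \<ge> M" "k \<ge> M" for m k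
      using cmod_hcoeff_le_norm[of "X m - X k" n] M[OF that]
      by (simp add: dist_norm)
    then show "\<exists>M. \<forall>m\<ge>M. \<forall>k\<ge>M. dist (hcoeff (X m) n) (hcoeff (X k) n) < e"
      by blast
  qed
  then have "\<exists>a. \<forall>n. (\<lambda>m. hcoeff (X m) n) \<longlonglongrightarrow> a n"
    by (intro choice allI) (simp add: Cauchy_convergent_iff convergent_def)
  then obtain a where a: "\<And>n. (\<lambda>m. hcoeff (X m) n) \<longlonglongrightarrow> a n"
    by blast
  \<comment> \<open>Stated for finite sums with \<open>M\<close> independent of \<open>N\<close>, so
    that letting \<open>k\<close> tend to infinity involves only finitely many coefficients.\<close>
  have tail: "\<exists>M. \<forall>m\<ge>M. \<forall>N. (\<Sum>n<N. (cmod (hcoeff (X m) n - a n))\<^sup>2) \<le> e\<^sup>2"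
    if e: "0 < e" for e :: real
  proof -
    obtain M where M: "\<And>m k. m \<ge> M \<Longrightarrow> k \<ge> M \<Longrightarrow> dist (X m) (X k) < e"
      using metric_CauchyD[OF X e] by blast
    have "(\<Sum>n<N. (cmod (hcoeff (X m) n - a n))\<^sup>2) \<le> e\<^sup>2" if m: "m \<ge> M" for m N
    proof (rule tendsto_upperbound)
      show "(\<lambda>k. \<Sum>n<N. (cmod (hcoeff (X m) n - hcoeff (X k) n))\<^sup>2)
          \<longlonglongrightarrow> (\<Sum>n<N. (cmod (hcoeff (X m) n - a n))\<^sup>2)"
        by (intro tendsto_intros a)
      show "\<forall>\<^sub>F k in sequentially. (\<Sum>n<N. (cmod (hcoeff (X m) n - hcoeff (X k) n))\<^sup>2) \<le> e\<^sup>2"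
        using eventually_ge_at_top[of M]
      proof eventually_elim
        fix k assume k: "k \<ge> M"
        have "(\<Sum>n<N. (cmod (hcoeff (X m - X k) n))\<^sup>2) \<le> (norm (X m - X k))\<^sup>2"
          unfolding norm_hardy2_power2 by (intro sum_le_suminf summable_hcoeff) auto
        also have "\<dots> \<le> e\<^sup>2"
          using M[OF m k] by (intro power_mono) (auto simp: dist_norm)
        finally show "(\<Sum>n<N. (cmod (hcoeff (X m) n - hcoeff (X k) n))\<^sup>2) \<le> e\<^sup>2"
          by simp
      qed
    qed simp
    then show ?thesis by blast
  qed
  from tail[of 1] obtain M where M: "\<And>N. (\<Sum>n<N. (cmod (hcoeff (X M) n - a n))\<^sup>2) \<le> 1"
    by auto
  have d: "summable (\<lambda>n. (cmod (hcoeff (X M) n - a n))\<^sup>2)"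
    by (rule bounded_imp_summable[of _ 1]) (use M[of "Suc _"] in \<open>auto simp: lessThan_Suc_atMost\<close>)
  \<comment> \<open>\<open>a\<close> is \<open>hcoeff (X M)\<close> minus a square summable
    difference.\<close>
  have "summable (\<lambda>n. (cmod (a n))\<^sup>2)"
    using summable_square_add[OF summable_hcoeff[of "X M"] summable_square_cmult[OF d, of "-1"]]
    by simp
  from hardy2_ex_coeff[OF this] obtain f where f: "\<And>n. hcoeff f n = a n"
    by blast
  have "X \<longlonglongrightarrow> f"
  proof (rule metric_LIMSEQ_I)
    fix r :: real assume r: "0 < r"
    with tail[of "r/2"] obtain M where
      M: "\<And>m N. m \<ge> M \<Longrightarrow> (\<Sum>n<N. (cmod (hcoeff (X m) n - a n))\<^sup>2) \<le> (r/2)\<^sup>2"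
      by (auto simp del: power_divide)
    have "norm (X m - f) \<le> r/2" if "m \<ge> M" for m
      by (rule norm_hardy2_le) (use M[OF that] r f in \<open>auto simp del: power_divide\<close>)
    then show "\<exists>no. \<forall>n\<ge>no. dist (X n) f < r"
      using r by (intro exI[of _ M]) (fastforce simp: dist_norm)
  qed
  then show "convergent X" by (rule convergentI)
qed

section \<open>Complex scalars and the monomial basis\<close>

lemma norm_hscaleC: "norm (hscaleC c f) = cmod c * norm f"
  unfolding norm_hardy2_def
  by (simp add: norm_mult power_mult_distrib suminf_mult summable_hcoeff real_sqrt_mult)

lemma bounded_linear_hscaleC: "bounded_linear (hscaleC c)"
  by (rule bounded_linear_intro[where K = "cmod c"])
    (auto intro!: hardy2_eqI simp: norm_hscaleC algebra_simps)

lift_definition hmonom :: "nat \<Rightarrow> hardy2" is "\<lambda>j z. if z \<in> ball 0 1 then z ^ j else 0"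
  subgoal for j
    by (rule hardy2_setI[of "\<lambda>n. if n = j then 1 else 0"])
      (auto simp: if_distrib if_distribR intro: sums_single cong: if_cong)
  done

lemma hcoeff_hmonom: "hcoeff (hmonom j) n = (if n = j then 1 else 0)"
proof (rule hcoeff_unique)
  fix z :: complex assume "cmod z < 1"
  then show "(\<lambda>n. (if n = j then 1 else 0) * z ^ n) sums heval (hmonom j) z"
    using sums_single[of j "\<lambda>n. z ^ n"]
    by transfer (simp add: if_distrib if_distribR cong: if_cong)
qed

lemma hmonom_sums: "(\<lambda>j. hscaleC (hcoeff f j) (hmonom j)) sums f"
  unfolding sums_def
proof (rule metric_LIMSEQ_I)
  fix r :: real assume r: "0 < r"
  let ?P = "\<lambda>n. \<Sum>j<n. hscaleC (hcoeff f j) (hmonom j)"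
  have P: "hcoeff (?P n) k = (if k < n then hcoeff f k else 0)" for n k
    by (induction n) (auto simp: hcoeff_hmonom less_Suc_eq)
  obtain N where N: "\<And>n. n \<ge> N \<Longrightarrow> norm (\<Sum>i. (cmod (hcoeff f (i + n)))\<^sup>2) < r\<^sup>2"
    using suminf_exist_split[OF _ summable_hcoeff[of f], of "r\<^sup>2"] r by auto
  have "dist (?P n) f < r" if "n \<ge> N" for n
  proof -
    have "(norm (?P n - f))\<^sup>2 = (\<Sum>i. (cmod (hcoeff (?P n - f) (i + n)))\<^sup>2)
        + (\<Sum>i<n. (cmod (hcoeff (?P n - f) i))\<^sup>2)"
      unfolding norm_hardy2_power2 by (rule suminf_split_initial_segment[OF summable_hcoeff])
    also have "\<dots> = (\<Sum>i. (cmod (hcoeff f (i + n)))\<^sup>2)"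
      by (simp add: P)
    also have "\<dots> < r\<^sup>2" using N[OF that] by simp
    finally show ?thesis
      using r by (simp add: dist_norm power2_less_imp_less)
  qed
  then show "\<exists>no. \<forall>n\<ge>no. dist (?P n) f < r" by blast
qed

section \<open>Contractivity and the binomial coefficients\<close>

text \<open>With b the averages of a, the difference |a - b|^2 - |a|^2 at index n + 1 is bounded by
  a telescoping term; the gap is exactly (n + 1) |b(n+1) - b(n)|^2. The telescoped sum is at most
  0.\<close>

lemma norm_id_minus_cesaro_le: "norm (id_blinfun - cesaro) \<le> 1"
proof (rule norm_blinfun_bound)
  fix f :: hardy2
  define a where "a = hcoeff f"
  define b where "b = hcoeff (blinfun_apply cesaro f)"
  have sum_a: "(\<Sum>j\<le>n. a j) = of_nat (Suc n) * b n" for n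
    by (simp add: a_def b_def hcoeff_cesaro del: of_nat_Suc)
  have a_Suc: "a (Suc n) = of_nat (Suc (Suc n)) * b (Suc n) - of_nat (Suc n) * b n" for n
    using sum_a[of "Suc n"] sum_a[of n] by (simp del: of_nat_Suc add: algebra_simps)
  have step: "(cmod (a (Suc n) - b (Suc n)))\<^sup>2 - (cmod (a (Suc n)))\<^sup>2
      \<le> Suc n * (cmod (b n))\<^sup>2 - Suc (Suc n) * (cmod (b (Suc n)))\<^sup>2" for n
  proof -
    have "0 \<le> real (Suc n) * (cmod (b (Suc n) - b n))\<^sup>2" by simp
    then show ?thesis
      unfolding a_Suc cmod_power2 by (simp add: algebra_simps power2_eq_square)
  qed
  have tele: "(\<Sum>n<Suc N. (cmod (a n - b n))\<^sup>2 - (cmod (a n))\<^sup>2) \<le> - (Suc N * (cmod (b N))\<^sup>2)" for N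
  proof (induction N)
    case 0
    show ?case using sum_a[of 0] by simp
  next
    case (Suc N)
    then show ?case using step[of N] by (simp del: of_nat_Suc)
  qed
  have part: "(\<Sum>n<N. (cmod (a n - b n))\<^sup>2) \<le> (\<Sum>n<N. (cmod (a n))\<^sup>2)" for N
  proof (cases N)
    case (Suc M)
    have "0 \<le> Suc M * (cmod (b M))\<^sup>2" by simp
    with tele[of M] show ?thesis unfolding Suc sum_subtractf by linarith
  qed simp
  have "norm (f - blinfun_apply cesaro f) \<le> norm f"
  proof (rule norm_hardy2_le)
    fix N
    have "(\<Sum>n<N. (cmod (a n))\<^sup>2) \<le> (norm f)\<^sup>2"
      unfolding norm_hardy2_power2 a_def by (intro sum_le_suminf summable_hcoeff) auto
    with part[of N] show "(\<Sum>n<N. (cmod (hcoeff (f - blinfun_apply cesaro f) n))\<^sup>2) \<le> (norm f)\<^sup>2"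
      by (simp add: a_def b_def)
  qed simp
  then show "norm (blinfun_apply (id_blinfun - cesaro) f) \<le> 1 * norm f"
    by (simp add: blinfun.diff_left)
qed simp

lemma norm_blinfun_power_le:
  assumes "norm T \<le> 1"
  shows "norm (blinfun_power T n) \<le> 1"
proof (induction n)
  case 0
  show ?case by (simp add: norm_blinfun_id_le)
next
  case (Suc n)
  have "norm (T o\<^sub>L blinfun_power T n) \<le> norm T * norm (blinfun_power T n)"
    by (rule norm_blinfun_compose)
  also have "\<dots> \<le> 1 * 1" using assms Suc by (intro mult_mono) auto
  finally show ?case by simp
qed

text \<open>The signed term is the rising factorial of -1/2 over a factorial, and that rising
  factorial is -1/2 times a positive one. Removing the absolute values makes the identities for
  binomial sums applicable.\<close>

lemma abs_gbinomial_half_Suc: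
  "\<bar>(1/2 :: real) gchoose Suc k\<bar> = - ((1/2 gchoose Suc k) * (- 1) ^ Suc k)"
proof -
  have "pochhammer (- (1/2) :: real) (Suc k) = - (1/2) * pochhammer (1/2) k"
    by (subst pochhammer_rec) simp
  moreover have "0 < pochhammer (1/2 :: real) k" by (rule pochhammer_pos) simp
  ultimately show ?thesis
    by (simp add: gbinomial_pochhammer abs_mult power_abs flip: power_mult_distrib)
qed

text \<open>The alternating partial sums have a closed form that is again a positive rising
  factorial over a factorial, so the absolute values sum to at most the initial term 1.\<close>

lemma summable_abs_gbinomial_half: "summable (\<lambda>k. \<bar>(1/2 :: real) gchoose Suc k\<bar>)"
proof (rule bounded_imp_summable[of _ 1])
  fix n
  have "(\<Sum>k\<le>Suc n. ((1/2 :: real) gchoose k) * (- 1) ^ k) = 1 - (\<Sum>k\<le>n. \<bar>(1/2 :: real) gchoose Suc k\<bar>)"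
    unfolding abs_gbinomial_half_Suc by (subst sum.atMost_Suc_shift) (simp add: sum_negf)
  moreover have "(\<Sum>k\<le>Suc n. ((1/2 :: real) gchoose k) * (- 1) ^ k)
      = (- 1) ^ Suc n * (1/2 - 1 gchoose Suc n)"
    by (rule gbinomial_sum_lower_neg)
  moreover have "(0::real) \<le> (- 1) ^ Suc n * (1/2 - 1 gchoose Suc n)"
  proof -
    have "0 < pochhammer (1/2 :: real) (Suc n)" by (rule pochhammer_pos) simp
    then show ?thesis
      by (simp add: gbinomial_pochhammer flip: power_mult_distrib)
  qed
  ultimately show "(\<Sum>k\<le>n. \<bar>(1/2 :: real) gchoose Suc k\<bar>) \<le> 1" by linarith
qed simp

text \<open>The binomial series at -x without its constant term. It is applied at x = 1 - 1/\<mu>,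
  which lies in [0, 1).\<close>

lemma abs_gbinomial_half_sums:
  assumes "\<bar>x\<bar> < 1"
  shows "(\<lambda>k. \<bar>(1/2 :: real) gchoose Suc k\<bar> * x ^ Suc k) sums (1 - sqrt (1 - x))"
proof -
  have "(\<lambda>k. (1/2 gchoose k) * (- x) ^ k) sums (1 + - x) powr (1/2)"
    using assms by (intro gen_binomial_real) simp
  then have "(\<lambda>k. (1/2 gchoose Suc k) * (- x) ^ Suc k) sums (sqrt (1 - x) - 1)"
    using assms by (subst sums_Suc_iff) (simp add: powr_half_sqrt)
  from sums_minus[OF this] show ?thesis
    unfolding abs_gbinomial_half_Suc by (simp add: power_minus[of x] mult_ac)
qed

section \<open>Eigenfunctionals of the Cesaro operator\<close>

text \<open>This is (-1)^j times the binomial coefficient of \<mu> - 1 over j, the j-th Taylor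
  coefficient of (1 - z)^(\<mu> - 1).\<close>

definition newton_coeff :: "nat \<Rightarrow> real \<Rightarrow> real" where
  "newton_coeff j \<mu> = (\<Prod>i<j. 1 - \<mu> / Suc i)"

lemma newton_coeff_0 [simp]: "newton_coeff 0 \<mu> = 1"
  by (simp add: newton_coeff_def)

lemma newton_coeff_Suc: "newton_coeff (Suc j) \<mu> = newton_coeff j \<mu> * (1 - \<mu> / Suc j)"
  by (simp add: newton_coeff_def)

text \<open>Up to index \<open>M\<close> each factor is at most \<open>M\<close> in absolute value.
  From there on the left side is nonincreasing in \<open>j\<close>, because \<mu> \<ge> 1 gives (j +
  2) (1 - \<mu>/(j + 1)) \<le> j + 1.\<close>

lemma newton_coeff_bound:
  assumes "1 \<le> \<mu>" "\<mu> \<le> real M"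
  shows "Suc j * \<bar>newton_coeff j \<mu>\<bar> \<le> Suc M * real M ^ M"
proof -
  have M: "1 \<le> real M" using assms by linarith
  have pow: "\<bar>newton_coeff j \<mu>\<bar> \<le> real M ^ j" for j
  proof (induction j)
    case (Suc j)
    have "\<mu> / Suc j \<le> \<mu>" "0 \<le> \<mu> / Suc j"
      using assms divide_left_mono[of 1 "Suc j" \<mu>] by auto
    then have "\<bar>1 - \<mu> / Suc j\<bar> \<le> real M"
      using assms(2) M unfolding abs_le_iff by linarith
    then have "\<bar>newton_coeff j \<mu>\<bar> * \<bar>1 - \<mu> / Suc j\<bar> \<le> real M ^ j * real M"
      using Suc by (intro mult_mono) auto
    then show ?case by (simp add: newton_coeff_Suc abs_mult mult.commute)
  qed simp
  have small: "Suc j * \<bar>newton_coeff j \<mu>\<bar> \<le> Suc M * real M ^ M" if "j \<le> M" for j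
  proof (intro mult_mono)
    show "\<bar>newton_coeff j \<mu>\<bar> \<le> real M ^ M"
      using pow[of j] power_increasing[OF that M] by linarith
  qed (use that in auto)
  show ?thesis
  proof (cases "j \<le> M")
    case False
    then have "M \<le> j" by simp
    then show ?thesis
    proof (induction j rule: dec_induct)
      case (step j)
      then have j: "\<mu> \<le> real (Suc j)" using assms(2) by simp
      have "real (Suc (Suc j)) * (1 - \<mu> / Suc j) \<le> real (Suc j)"
      proof -
        have "real (Suc (Suc j)) * (real (Suc j) - \<mu>) \<le> real (Suc (Suc j)) * (real (Suc j) - 1)"
          using assms(1) by (intro mult_left_mono) auto
        also have "\<dots> \<le> real (Suc j) * real (Suc j)" by (simp add: algebra_simps)
        finally show ?thesis by (simp add: field_simps)
      qed
      moreover have "\<bar>1 - \<mu> / Suc j\<bar> = 1 - \<mu> / Suc j"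
        using j by (simp del: of_nat_Suc)
      ultimately have "\<bar>newton_coeff j \<mu>\<bar> * (real (Suc (Suc j)) * \<bar>1 - \<mu> / Suc j\<bar>)
          \<le> \<bar>newton_coeff j \<mu>\<bar> * real (Suc j)"
        by (intro mult_left_mono) auto
      then have "Suc (Suc j) * \<bar>newton_coeff (Suc j) \<mu>\<bar> \<le> Suc j * \<bar>newton_coeff j \<mu>\<bar>"
        by (simp only: newton_coeff_Suc abs_mult mult_ac)
      also note step.IH
      finally show ?case .
    qed (rule small, simp)
  qed (rule small)
qed

text \<open>The decay rate makes the coefficients square summable; that \<open>K\<close> serves all
  \<mu> in [1, m] gives continuity in \<mu> later.\<close>

lemma newton_coeff_boundE:
  assumes "1 \<le> m"
  obtains K where "\<And>j \<mu>. 1 \<le> \<mu> \<Longrightarrow> \<mu> \<le> m \<Longrightarrow> \<bar>newton_coeff j \<mu>\<bar> \<le> K / Suc j"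
proof -
  obtain M :: nat where M: "m \<le> real M" using real_arch_simple by blast
  show ?thesis
  proof (rule that[of "Suc M * real M ^ M"])
    fix j and \<mu> :: real assume "1 \<le> \<mu>" "\<mu> \<le> m"
    with newton_coeff_bound[of \<mu> M j] M
    show "\<bar>newton_coeff j \<mu>\<bar> \<le> Suc M * real M ^ M / Suc j"
      by (simp add: field_simps del: of_nat_Suc)
  qed
qed

lemma newton_coeff_root: "j > n \<Longrightarrow> newton_coeff j (real (Suc n)) = 0"
  by (auto simp: newton_coeff_def intro!: bexI[of _ n])

lemma newton_coeff_diag_nonzero: "newton_coeff n (real (Suc n)) \<noteq> 0"
  by (auto simp: newton_coeff_def field_simps)

section \<open>The functionals on the Hardy space\<close>

lemma summable_mult_of_square_summable:
  fixes a b :: "nat \<Rightarrow> real"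
  assumes "summable (\<lambda>n. (a n)\<^sup>2)" "summable (\<lambda>n. (b n)\<^sup>2)"
  shows "summable (\<lambda>n. a n * b n)"
proof (rule summable_comparison_test'[where N = 0])
  show "summable (\<lambda>n. (a n)\<^sup>2 + (b n)\<^sup>2)" using assms by (rule summable_add)
  show "norm (a n * b n) \<le> (a n)\<^sup>2 + (b n)\<^sup>2" for n
    using sum_squares_bound[of "\<bar>a n\<bar>" "\<bar>b n\<bar>"] mult_nonneg_nonneg[of "\<bar>a n\<bar>" "\<bar>b n\<bar>"]
    by (simp add: abs_mult mult.assoc del: mult_nonneg_nonneg)
qed

lemma summable_square_const_divide_Suc: "summable (\<lambda>n. (K / Suc n)\<^sup>2 :: real)"
proof -
  have "summable (\<lambda>n. inverse (real (Suc n) ^ 2))"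
    using inverse_power_summable[of 2, where 'a = real]
    by (subst summable_Suc_iff) simp
  from summable_mult[OF this, of "K\<^sup>2"] show ?thesis
    by (simp only: power_divide divide_inverse power_mult_distrib power_inverse)
qed

lemma summable_divide_Suc_hcoeff: "summable (\<lambda>j. K / Suc j * cmod (hcoeff f j))"
  by (intro summable_mult_of_square_summable summable_square_const_divide_Suc summable_hcoeff)

definition newton_fun :: "real \<Rightarrow> hardy2 \<Rightarrow> complex" where
  "newton_fun \<mu> f = (\<Sum>j. of_real (newton_coeff j \<mu>) * hcoeff f j)"

lemma newton_fun_summable:
  assumes "1 \<le> \<mu>"
  shows "summable (\<lambda>j. of_real (newton_coeff j \<mu>) * hcoeff f j)"
proof -
  obtain K where K: "\<And>j. \<bar>newton_coeff j \<mu>\<bar> \<le> K / Suc j"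
    using newton_coeff_boundE[OF assms] assms by (metis order_refl)
  show ?thesis
    by (rule summable_comparison_test'[OF summable_divide_Suc_hcoeff[of K f], where N = 0])
      (use mult_right_mono[OF K norm_ge_zero] in \<open>simp add: norm_mult del: of_nat_Suc\<close>)
qed

lemma newton_fun_hscaleC:
  "1 \<le> \<mu> \<Longrightarrow> newton_fun \<mu> (hscaleC c f) = c * newton_fun \<mu> f"
  using suminf_mult[OF newton_fun_summable[of \<mu> f], of c]
  by (simp add: newton_fun_def mult.left_commute)

text \<open>The functional is represented by the element \<open>P\<close> with these coefficients.
  Since \<open>inner\<close> is only the real part of the complex inner product, the imaginary part
  is recovered by rotating \<open>f\<close> by -i.\<close>

lemma bounded_linear_newton_fun:
  assumes "1 \<le> \<mu>"
  shows "bounded_linear (newton_fun \<mu>)"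
proof -
  obtain K where K: "\<And>j. \<bar>newton_coeff j \<mu>\<bar> \<le> K / Suc j"
    using newton_coeff_boundE[OF assms] assms by (metis order_refl)
  have "summable (\<lambda>j. (cmod (of_real (newton_coeff j \<mu>)))\<^sup>2)"
    by (rule summable_comparison_test'[OF summable_square_const_divide_Suc[of K], where N = 0])
      (use power_mono[OF K abs_ge_zero, where n = 2] in \<open>simp del: of_nat_Suc\<close>)
  from hardy2_ex_coeff[OF this] obtain P where P: "\<And>j. hcoeff P j = of_real (newton_coeff j \<mu>)"
    by blast
  have Re: "Re (newton_fun \<mu> f) = inner f P" for f
    unfolding newton_fun_def inner_hardy2_def P
    by (subst bounded_linear.suminf[OF bounded_linear_Re newton_fun_summable[OF assms]])
      (simp add: mult.commute)
  have "Im (newton_fun \<mu> f) = inner (hscaleC (- \<i>) f) P" for f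
    by (subst Re[symmetric]) (simp add: newton_fun_hscaleC[OF assms])
  with Re have "newton_fun \<mu> = (\<lambda>f. of_real (inner f P) + \<i> * of_real (inner (hscaleC (- \<i>) f) P))"
    by (auto simp: fun_eq_iff complex_eq_iff)
  then show ?thesis
    by (auto intro!: bounded_linear_add bounded_linear_const_mult bounded_linear_ident
      bounded_linear_compose[OF bounded_linear_of_real]
      bounded_linear_compose[OF bounded_linear_inner_left] bounded_linear_hscaleC)
qed

lemma newton_fun_cesaro:
  assumes "1 \<le> \<mu>"
  shows "newton_fun \<mu> (blinfun_apply cesaro f) = newton_fun \<mu> f / of_real \<mu>"
proof -
  let ?p = "\<lambda>j. complex_of_real (newton_coeff j \<mu>)"
  let ?b = "hcoeff (blinfun_apply cesaro f)"
  \<comment> \<open>At n = 0 the truncated index \<open>n - 1\<close> is harmless, as both sides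
    vanish.\<close>
  have sum_f: "(\<Sum>j<n. hcoeff f j) = of_nat n * ?b (n - 1)" for n
    by (cases n) (simp_all add: hcoeff_cesaro lessThan_Suc_atMost del: of_nat_Suc)
  \<comment> \<open>Summation by parts, resting on p(n+1) (n + 1) = p(n) (n + 1 - \<mu>).\<close>
  have parts: "(\<Sum>j<n. ?p j * hcoeff f j)
      = of_real \<mu> * (\<Sum>j<n. ?p j * ?b j) + ?p n * (\<Sum>j<n. hcoeff f j)" for n
  proof (induction n)
    case (Suc n)
    have "?p (Suc n) * of_nat (Suc n) = ?p n * (of_nat (Suc n) - of_real \<mu>)"
      by (simp add: newton_coeff_Suc right_diff_distrib left_diff_distrib mult.assoc del: of_nat_Suc)
    then have "?p (Suc n) * (\<Sum>j<Suc n. hcoeff f j) = ?p n * (of_nat (Suc n) - of_real \<mu>) * ?b n"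
      unfolding sum_f by (simp only: diff_Suc_1 mult.assoc[symmetric])
    moreover have "(\<Sum>j<n. hcoeff f j) + hcoeff f n = of_nat (Suc n) * ?b n"
      using sum_f[of "Suc n"] by simp
    then have "?p n * (\<Sum>j<n. hcoeff f j) + ?p n * hcoeff f n = ?p n * of_nat (Suc n) * ?b n"
      by (simp only: distrib_left[symmetric] mult.assoc)
    ultimately show ?case
      using Suc unfolding sum.lessThan_Suc[of "\<lambda>j. ?p j * _ j"]
      by (simp only: distrib_left right_diff_distrib left_diff_distrib) (simp add: algebra_simps)
  qed simp
  obtain K where K: "\<And>j. \<bar>newton_coeff j \<mu>\<bar> \<le> K / Suc j"
    using newton_coeff_boundE[OF assms] assms by (metis order_refl)
  have b0: "?b \<longlonglongrightarrow> 0"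
    using tendsto_real_sqrt[OF summable_LIMSEQ_zero[OF summable_hcoeff[of "blinfun_apply cesaro f"]]]
    by (simp add: tendsto_norm_zero_iff)
  \<comment> \<open>The boundary term vanishes in the limit: the partial sum is (n + 1) b(n), the
    factor n + 1 is absorbed by the decay of p, and b tends to 0.\<close>
  have "(\<lambda>n. ?p (Suc n) * (\<Sum>j<Suc n. hcoeff f j)) \<longlonglongrightarrow> 0"
  proof (rule Lim_null_comparison)
    show "(\<lambda>n. K * cmod (?b n)) \<longlonglongrightarrow> 0"
      using tendsto_mult_right_zero[OF tendsto_norm_zero[OF b0]] .
    have "cmod (?p (Suc n) * (\<Sum>j<Suc n. hcoeff f j)) \<le> K * cmod (?b n)" for n
    proof -
      have "\<bar>newton_coeff (Suc n) \<mu>\<bar> * Suc n \<le> \<bar>newton_coeff (Suc n) \<mu>\<bar> * Suc (Suc n)"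
        by (intro mult_left_mono) auto
      also have "\<dots> \<le> K" using K[of "Suc n"] by (simp add: field_simps)
      finally have "\<bar>newton_coeff (Suc n) \<mu>\<bar> * Suc n * cmod (?b n) \<le> K * cmod (?b n)"
        by (rule mult_right_mono) simp
      then show ?thesis
        unfolding sum_f by (simp add: norm_mult mult.assoc del: of_nat_Suc)
    qed
    then show "\<forall>\<^sub>F n in sequentially. cmod (?p (Suc n) * (\<Sum>j<Suc n. hcoeff f j)) \<le> K * cmod (?b n)"
      by simp
  qed
  then have "(\<lambda>n. ?p n * (\<Sum>j<n. hcoeff f j)) \<longlonglongrightarrow> 0"
    by (rule LIMSEQ_imp_Suc)
  from tendsto_add[OF tendsto_mult_left[OF
      summable_LIMSEQ[OF newton_fun_summable[OF assms]], of "of_real \<mu>"] this]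
  have "(\<lambda>n. \<Sum>j<n. ?p j * hcoeff f j)
      \<longlonglongrightarrow> of_real \<mu> * newton_fun \<mu> (blinfun_apply cesaro f)"
    unfolding parts newton_fun_def by simp
  with summable_LIMSEQ[OF newton_fun_summable[OF assms, of f]]
  have "newton_fun \<mu> f = of_real \<mu> * newton_fun \<mu> (blinfun_apply cesaro f)"
    unfolding newton_fun_def by (rule LIMSEQ_unique)
  then show ?thesis using assms by simp
qed

text \<open>At the integer \<open>n + 1\<close> the functional only sees the coefficients up to \<open>n\<close>.\<close>

lemma newton_fun_separates:
  assumes "\<And>n. newton_fun (real (Suc n)) f = newton_fun (real (Suc n)) g"
  shows "f = g"
proof (rule hardy2_eqI)
  fix n
  show "hcoeff f n = hcoeff g n"
  proof (induction n rule: less_induct)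
    case (less n)
    have "newton_fun (real (Suc n)) h
        = (\<Sum>j<n. of_real (newton_coeff j (Suc n)) * hcoeff h j)
          + of_real (newton_coeff n (Suc n)) * hcoeff h n" for h
      unfolding newton_fun_def
      by (subst suminf_finite[of "{..<Suc n}"]) (auto simp: newton_coeff_root simp del: of_nat_Suc)
    moreover have "(\<Sum>j<n. of_real (newton_coeff j (Suc n)) * hcoeff f j)
        = (\<Sum>j<n. of_real (newton_coeff j (Suc n)) * hcoeff g j)"
      using less by (intro sum.cong) auto
    ultimately show ?case
      using assms[of n] newton_coeff_diag_nonzero[of n] by (simp del: of_nat_Suc)
  qed
qed

text \<open>On each [1, m] the series converges uniformly by the M-test with the bound
  \<open>K\<close>, and its partial sums are polynomials in \<mu>.\<close>

lemma continuous_on_newton_fun: "continuous_on {1..} (\<lambda>\<mu>. newton_fun \<mu> f)"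
proof -
  have "continuous_on {1..m} (\<lambda>\<mu>. newton_fun \<mu> f)" if m: "1 \<le> m" for m
  proof -
    obtain K where K: "\<And>j \<mu>. 1 \<le> \<mu> \<Longrightarrow> \<mu> \<le> m \<Longrightarrow> \<bar>newton_coeff j \<mu>\<bar> \<le> K / Suc j"
      using newton_coeff_boundE[OF m] by metis
    have "uniform_limit {1..m} (\<lambda>n \<mu>. \<Sum>j<n. of_real (newton_coeff j \<mu>) * hcoeff f j)
        (\<lambda>\<mu>. newton_fun \<mu> f) sequentially"
      unfolding newton_fun_def
      by (rule Weierstrass_m_test[OF _ summable_divide_Suc_hcoeff[of K f]])
        (simp only: norm_mult norm_of_real, rule mult_right_mono[OF K norm_ge_zero], auto)
    then show ?thesis
    proof (rule uniform_limit_theorem[rotated])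
      show "\<forall>\<^sub>F n in sequentially.
          continuous_on {1..m} (\<lambda>\<mu>. \<Sum>j<n. of_real (newton_coeff j \<mu>) * hcoeff f j)"
        unfolding newton_coeff_def by (intro always_eventually allI continuous_intros) auto
    qed simp
  qed
  note cont = this
  show ?thesis
    unfolding continuous_on_eq_continuous_within
  proof
    fix x :: real assume x: "x \<in> {1..}"
    then have "continuous (at x within {1..x + 1}) (\<lambda>\<mu>. newton_fun \<mu> f)"
      using cont[of "x + 1"] by (auto simp: continuous_on_eq_continuous_within)
    moreover have "at x within {1..x + 1} = at x within {1..}"
      by (rule at_within_nhd[of _ "{..<x + 1}"]) auto
    ultimately show "continuous (at x within {1..}) (\<lambda>\<mu>. newton_fun \<mu> f)"
      by (simp add: continuous_within)
  qed
qed

section \<open>Uniqueness of the eigenfunctionals\<close>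

lemma cesaro_hmonom_diff:
  "blinfun_apply cesaro (hmonom j) - blinfun_apply cesaro (hmonom (Suc j))
    = hscaleC (1 / of_nat (Suc j)) (hmonom j)"
  by (rule hardy2_eqI) (auto simp: hcoeff_cesaro hcoeff_hmonom simp del: of_nat_Suc)

lemma eigenfunctional_unique:
  assumes "1 \<le> \<mu>" and bl: "bounded_linear \<psi>"
    and sc: "\<And>c f. \<psi> (hscaleC c f) = c * \<psi> f"
    and eig: "\<And>f. \<psi> (blinfun_apply cesaro f) = \<psi> f / of_real \<mu>"
  shows "\<psi> f = \<psi> (hmonom 0) * newton_fun \<mu> f"
proof -
  have monom: "\<psi> (hmonom j) = \<psi> (hmonom 0) * of_real (newton_coeff j \<mu>)" for j
  proof (induction j)
    case (Suc j)
    \<comment> \<open>The images of consecutive monomials under C differ in a single coefficient, so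
      the eigenvalue equation becomes the recurrence of \<open>newton_coeff\<close>. Continuity then
      extends the formula from monomials to \<open>f\<close>.\<close>
    have "\<psi> (hmonom j) / of_real \<mu> - \<psi> (hmonom (Suc j)) / of_real \<mu>
        = \<psi> (hmonom j) / of_nat (Suc j)"
      using arg_cong[OF cesaro_hmonom_diff[of j], of \<psi>]
      by (simp add: linear_diff[OF bounded_linear.linear[OF bl]] eig sc del: of_nat_Suc)
    then have "\<psi> (hmonom (Suc j)) = \<psi> (hmonom j) * (1 - of_real \<mu> / of_nat (Suc j))"
      using assms(1) by (simp add: field_simps del: of_nat_Suc)
    then show ?case using Suc by (simp add: newton_coeff_Suc)
  qed simp
  have "\<psi> (hscaleC (hcoeff f j) (hmonom j))
      = \<psi> (hmonom 0) * (of_real (newton_coeff j \<mu>) * hcoeff f j)" for j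
    by (simp only: sc monom[of j] mult_ac)
  with bounded_linear.sums[OF bl hmonom_sums[of f]]
  have "(\<lambda>j. \<psi> (hmonom 0) * (of_real (newton_coeff j \<mu>) * hcoeff f j)) sums \<psi> f"
    by simp
  moreover have "(\<lambda>j. \<psi> (hmonom 0) * (of_real (newton_coeff j \<mu>) * hcoeff f j))
      sums (\<psi> (hmonom 0) * newton_fun \<mu> f)"
    unfolding newton_fun_def
    by (intro sums_mult summable_sums newton_fun_summable assms(1))
  ultimately show ?thesis by (rule sums_unique2)
qed

section \<open>Square roots of the Cesaro operator\<close>

lemma summable_cesaro_sqrt_series:
  "summable (\<lambda>k. \<bar>(1/2 :: real) gchoose Suc k\<bar> *\<^sub>R blinfun_power (id_blinfun - cesaro) (Suc k))"
proof (rule summable_comparison_test'[OF summable_abs_gbinomial_half, where N = 0])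
  fix k
  show "norm (\<bar>(1/2 :: real) gchoose Suc k\<bar> *\<^sub>R blinfun_power (id_blinfun - cesaro) (Suc k))
      \<le> \<bar>(1/2 :: real) gchoose Suc k\<bar>"
    using norm_blinfun_power_le[OF norm_id_minus_cesaro_le, of "Suc k"]
    by (simp add: mult_left_le del: blinfun_power.simps)
qed

lemma newton_fun_power:
  assumes "1 \<le> \<mu>"
  shows "newton_fun \<mu> (blinfun_apply (blinfun_power (id_blinfun - cesaro) k) f)
    = of_real ((1 - 1 / \<mu>) ^ k) * newton_fun \<mu> f"
proof (induction k)
  case (Suc k)
  then show ?case
    by (simp add: blinfun.diff_left linear_diff[OF bounded_linear.linear[OF
      bounded_linear_newton_fun[OF assms]]] newton_fun_cesaro[OF assms] algebra_simps)
qed simp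

definition cesaro_sqrt :: "hardy2 \<Rightarrow>\<^sub>L hardy2" where
  "cesaro_sqrt = id_blinfun -
    (\<Sum>k. \<bar>(1/2 :: real) gchoose Suc k\<bar> *\<^sub>R blinfun_power (id_blinfun - cesaro) (Suc k))"

text \<open>I - C acts through the functional as the scalar 1 - 1/\<mu>, so the operator series
  turns into the scalar one, with sum 1 - 1 / sqrt \<mu>.\<close>

lemma newton_fun_cesaro_sqrt:
  assumes "1 \<le> \<mu>"
  shows "newton_fun \<mu> (blinfun_apply cesaro_sqrt f) = newton_fun \<mu> f / of_real (sqrt \<mu>)"
proof -
  let ?c = "\<lambda>k. \<bar>(1/2 :: real) gchoose Suc k\<bar>"
  let ?T = "\<lambda>k. blinfun_power (id_blinfun - cesaro) (Suc k)"
  note bl = bounded_linear_newton_fun[OF assms]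
  have "bounded_linear (\<lambda>X. newton_fun \<mu> (blinfun_apply X f))"
    by (rule bounded_linear_compose[OF bl blinfun.bounded_linear_left])
  from bounded_linear.sums[OF this summable_sums[OF summable_cesaro_sqrt_series]]
  have "(\<lambda>k. newton_fun \<mu> (blinfun_apply (?c k *\<^sub>R ?T k) f))
      sums newton_fun \<mu> (blinfun_apply (\<Sum>k. ?c k *\<^sub>R ?T k) f)" .
  moreover have "newton_fun \<mu> (blinfun_apply (?c k *\<^sub>R ?T k) f)
      = of_real (?c k * (1 - 1 / \<mu>) ^ Suc k) * newton_fun \<mu> f" for k
    by (simp add: blinfun.scaleR_left linear_cmul[OF bounded_linear.linear[OF bl]]
      newton_fun_power[OF assms] scaleR_conv_of_real del: blinfun_power.simps)
  moreover have "(\<lambda>k. of_real (?c k * (1 - 1 / \<mu>) ^ Suc k) * newton_fun \<mu> f)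
      sums (of_real (1 - sqrt (1 - (1 - 1 / \<mu>))) * newton_fun \<mu> f)"
    using assms by (intro sums_mult2 sums_of_real abs_gbinomial_half_sums) (simp add: field_simps)
  ultimately have "newton_fun \<mu> (blinfun_apply (\<Sum>k. ?c k *\<^sub>R ?T k) f)
      = of_real (1 - sqrt (1 - (1 - 1 / \<mu>))) * newton_fun \<mu> f"
    by (simp only: sums_unique2)
  then show ?thesis
    by (simp add: cesaro_sqrt_def blinfun.diff_left
      linear_diff[OF bounded_linear.linear[OF bl]] real_sqrt_divide algebra_simps
      del: blinfun_power.simps)
qed

text \<open>No product of operator series is formed: both sides act as 1/\<mu> on the separating
  functionals at integer \<mu>.\<close>

lemma cesaro_sqrt_squared:
  "blinfun_apply cesaro_sqrt (blinfun_apply cesaro_sqrt f) = blinfun_apply cesaro f"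
proof (rule newton_fun_separates)
  fix n
  have "complex_of_real (sqrt (Suc n)) * of_real (sqrt (Suc n)) = of_real (Suc n)"
    unfolding of_real_mult[symmetric] by (simp del: of_nat_Suc)
  then show "newton_fun (Suc n) (blinfun_apply cesaro_sqrt (blinfun_apply cesaro_sqrt f))
      = newton_fun (Suc n) (blinfun_apply cesaro f)"
    by (simp add: newton_fun_cesaro_sqrt newton_fun_cesaro del: of_nat_Suc)
qed

section \<open>Classification of the square roots\<close>

lemma square_root_cesaro:
  assumes A: "A \<in> hardy2_operators"
    and sq: "\<And>f. blinfun_apply A (blinfun_apply A f) = blinfun_apply cesaro f"
  shows "A = cesaro_sqrt \<or> A = - cesaro_sqrt"
proof -
  define \<alpha> where "\<alpha> \<mu> = newton_fun \<mu> (blinfun_apply A (hmonom 0))" for \<mu>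
  have eigen: "newton_fun \<mu> (blinfun_apply A f) = \<alpha> \<mu> * newton_fun \<mu> f" if \<mu>: "1 \<le> \<mu>" for \<mu> f
    unfolding \<alpha>_def
  proof (rule eigenfunctional_unique[OF \<mu>])
    show "bounded_linear (\<lambda>f. newton_fun \<mu> (blinfun_apply A f))"
      by (rule bounded_linear_compose[OF bounded_linear_newton_fun[OF \<mu>] blinfun.bounded_linear_right])
    \<comment> \<open>Complex linearity of \<open>A\<close> enters here.\<close>
    show "newton_fun \<mu> (blinfun_apply A (hscaleC c f)) = c * newton_fun \<mu> (blinfun_apply A f)" for c f
      using A by (simp add: hardy2_operators_def newton_fun_hscaleC[OF \<mu>])
    \<comment> \<open>\<open>A\<close> commutes with C, since both products are the cube of
      \<open>A\<close>.\<close>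
    show "newton_fun \<mu> (blinfun_apply A (blinfun_apply cesaro f))
        = newton_fun \<mu> (blinfun_apply A f) / of_real \<mu>" for f
      by (simp add: newton_fun_cesaro[OF \<mu>, symmetric] flip: sq)
  qed
  have "newton_fun \<mu> (hmonom 0) = 1" for \<mu>
    unfolding newton_fun_def by (subst suminf_finite[of "{0}"]) (auto simp: hcoeff_hmonom)
  then have \<alpha>_sq: "(\<alpha> \<mu>)\<^sup>2 = 1 / of_real \<mu>" if "1 \<le> \<mu>" for \<mu>
    using eigen[OF that, of "blinfun_apply A (hmonom 0)"] newton_fun_cesaro[OF that, of "hmonom 0"]
    by (simp add: sq \<alpha>_def power2_eq_square)
  \<comment> \<open>Rescaling turns the two possible eigenvalues into the fixed signs 1 and -1; a
    continuous function with finite range on the connected set [1, \<infinity>) is constant.\<close>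
  define \<beta> where "\<beta> \<mu> = of_real (sqrt \<mu>) * \<alpha> \<mu>" for \<mu>
  have \<beta>: "\<beta> \<mu> \<in> {1, - 1}" if "1 \<le> \<mu>" for \<mu>
  proof -
    have "(\<beta> \<mu>)\<^sup>2 = 1"
      using that by (simp add: \<beta>_def power_mult_distrib \<alpha>_sq flip: of_real_power)
    then show ?thesis by (simp add: power2_eq_1_iff)
  qed
  have "continuous_on {1..} \<beta>"
    unfolding \<beta>_def \<alpha>_def by (intro continuous_intros continuous_on_newton_fun)
  then have "\<beta> constant_on {1..}"
    by (rule continuous_finite_range_constant[rotated])
      (auto intro: finite_subset[of _ "{1, - 1}"] dest: \<beta>)
  then obtain \<epsilon> where \<epsilon>: "\<And>\<mu>. 1 \<le> \<mu> \<Longrightarrow> \<beta> \<mu> = \<epsilon>"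
    by (auto simp: constant_on_def)
  have "\<epsilon> = 1 \<or> \<epsilon> = - 1" using \<beta>[of 1] \<epsilon>[of 1] by auto
  have "newton_fun \<mu> (blinfun_apply A f) = \<epsilon> * newton_fun \<mu> (blinfun_apply cesaro_sqrt f)"
    if "1 \<le> \<mu>" for \<mu> f
    using \<epsilon>[OF that, symmetric] that by (simp add: eigen newton_fun_cesaro_sqrt \<beta>_def)
  then have "blinfun_apply A f = hscaleC \<epsilon> (blinfun_apply cesaro_sqrt f)" for f
    by (intro newton_fun_separates) (simp add: newton_fun_hscaleC del: of_nat_Suc)
  moreover have "hscaleC 1 f = f" "hscaleC (- 1) f = - f" for f
    by (auto intro: hardy2_eqI)
  ultimately show ?thesis
    using \<open>\<epsilon> = 1 \<or> \<epsilon> = - 1\<close> by (auto intro!: blinfun_eqI simp: blinfun.minus_left)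
qed

theorem theorem7p2:
  fixes A :: "hardy2 \<Rightarrow>\<^sub>L hardy2"
  assumes "A \<in> hardy2_operators"
  shows "summable (\<lambda>k. \<bar>(1/2 :: real) gchoose Suc k\<bar> *\<^sub>R
             blinfun_power (id_blinfun - cesaro) (Suc k)) \<and>
    (blinfun_power A 2 = cesaro \<longleftrightarrow>
       A = id_blinfun - (\<Sum>k. \<bar>(1/2 :: real) gchoose Suc k\<bar> *\<^sub>R
             blinfun_power (id_blinfun - cesaro) (Suc k)) \<or>
       A = - (id_blinfun - (\<Sum>k. \<bar>(1/2 :: real) gchoose Suc k\<bar> *\<^sub>R
             blinfun_power (id_blinfun - cesaro) (Suc k))))"
proof -
  have "blinfun_power A 2 = cesaro
      \<longleftrightarrow> (\<forall>f. blinfun_apply A (blinfun_apply A f) = blinfun_apply cesaro f)"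
    by (simp add: numeral_2_eq_2 fun_eq_iff flip: blinfun_apply_inject)
  moreover have "\<dots> \<longleftrightarrow> A = cesaro_sqrt \<or> A = - cesaro_sqrt"
    using square_root_cesaro[OF assms]
    by (auto simp: cesaro_sqrt_squared blinfun.minus_left blinfun.minus_right)
  ultimately show ?thesis
    using summable_cesaro_sqrt_series unfolding cesaro_sqrt_def by blast
qed

end
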